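(* Let $$\hat\ell=\min\Big\{\langle F,X\rangle+c^\top x+\alpha\ \Big|\ \begin{bmatrix} 1 & x^\top \\ x & X \end{bmatrix}\succcurlyeq0,\ \operatorname{diag}(X)=e\Big\},\qquad \hat u=\max\Big\{\langle F,X\rangle+c^\top x+\alpha\ \Big|\ \begin{bmatrix} 1 & x^\top \\ x & X \end{bmatrix}\succcurlyeq0,\ \operatorname{diag}(X)=e\Big\},$$ where $X$ ranges over symmetric $n\times n$ real matrices and $x$ over $\mathbb{R}^n$. Put $\rho_{\mathrm{Las}}=\max\{|\hat\ell|,|\hat u|\}$ and $\sigma_{\mathrm{Las}}=2\max\{|\hat\ell|,|\hat u|\}+1$. Then: (1) there is no $x\in\Delta$ with $f(x)>\rho_{\mathrm{Las}}$; (2) for every $x\in\Delta^c$, $f(x)+\sigma_{\mathrm{Las}}\lVert Ax-b\rVert^2>\rho_{\mathrm{Las}}$.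
   Context: Let $\hat F\in\mathbb{R}^{n\times n}$ be symmetric, $\hat c\in\mathbb{R}^n$, $\hat A\in\mathbb{Z}^{m\times n}$, $\hat b\in\mathbb{Z}^m$. With $e$ the all-ones vector, let $F=\frac14\hat F$, $c=\frac12(\hat c+\hat Fe)$, $\alpha=\frac12\hat c^\top e+\frac14e^\top\hat Fe$, $A=\frac12\hat A$, $b=\hat b-\frac12\hat Ae$. Set $f(x)=x^\top Fx+c^\top x+\alpha$, $\Delta=\{x\in\{-1,1\}^n\mid Ax=b\}$ and $\Delta^c=\{x\in\{-1,1\}^n\mid Ax\neq b\}$. $\lVert\cdot\rVert$ is the Euclidean norm, $\langle F,X\rangle=\operatorname{tr}(X^\top F)$, $\operatorname{diag}(X)$ is the vector of diagonal entries of $X$, and $\succcurlyeq0$ means positive semidefinite. *)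

theory Defs
  imports "HOL-Analysis.Analysis"
begin

definition symmetric_matrix :: "real^'k^'k \<Rightarrow> bool" where
  "symmetric_matrix M \<longleftrightarrow> transpose M = M"

definition pos_semidef :: "real^'k^'k \<Rightarrow> bool" where
  "pos_semidef M \<longleftrightarrow> symmetric_matrix M \<and> (\<forall>v. 0 \<le> v \<bullet> (M *v v))"

definition diag_vec :: "real^'n^'n \<Rightarrow> real^'n" where
  "diag_vec X = (\<chi> i. X $ i $ i)"

definition frob_inner :: "real^'n^'n \<Rightarrow> real^'n^'n \<Rightarrow> real" where
  "frob_inner M X = trace (transpose X ** M)"

text \<open>The block matrix \<open>[1, x\<^sup>T; x, X]\<close> of size \<open>n + 1\<close>: its index type is
  \<open>'n option\<close>, where \<open>None\<close> is the extra first row and column.\<close>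

definition bordered :: "real^'n \<Rightarrow> real^'n^'n \<Rightarrow> real^('n option)^('n option)" where
  "bordered x X = (\<chi> i j. case i of
       None \<Rightarrow> (case j of None \<Rightarrow> 1 | Some l \<Rightarrow> x $ l)
     | Some k \<Rightarrow> (case j of None \<Rightarrow> x $ k | Some l \<Rightarrow> X $ k $ l))"

definition sdp_feasible :: "((real^'n^'n) \<times> (real^'n)) set" where
  "sdp_feasible = {(X, x). symmetric_matrix X \<and> pos_semidef (bordered x X) \<and> diag_vec X = 1}"

definition sdp_values :: "real^'n^'n \<Rightarrow> real^'n \<Rightarrow> real \<Rightarrow> real set" where
  "sdp_values F c \<alpha> = {frob_inner F X + c \<bullet> x + \<alpha> | X x. (X, x) \<in> sdp_feasible}"

text \<open>As the extrema are written with \<open>LEAST\<close> and \<open>GREATEST\<close>, nothing follows about their values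
  before attainment is proved.\<close>

definition l_hat :: "real^'n^'n \<Rightarrow> real^'n \<Rightarrow> real \<Rightarrow> real" where
  "l_hat F c \<alpha> = (LEAST v. v \<in> sdp_values F c \<alpha>)"

definition u_hat :: "real^'n^'n \<Rightarrow> real^'n \<Rightarrow> real \<Rightarrow> real" where
  "u_hat F c \<alpha> = (GREATEST v. v \<in> sdp_values F c \<alpha>)"

definition rho_Las :: "real^'n^'n \<Rightarrow> real^'n \<Rightarrow> real \<Rightarrow> real" where
  "rho_Las F c \<alpha> = max \<bar>l_hat F c \<alpha>\<bar> \<bar>u_hat F c \<alpha>\<bar>"

definition sigma_Las :: "real^'n^'n \<Rightarrow> real^'n \<Rightarrow> real \<Rightarrow> real" where
  "sigma_Las F c \<alpha> = 2 * max \<bar>l_hat F c \<alpha>\<bar> \<bar>u_hat F c \<alpha>\<bar> + 1"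

definition quad_fun :: "real^'n^'n \<Rightarrow> real^'n \<Rightarrow> real \<Rightarrow> real^'n \<Rightarrow> real" where
  "quad_fun F c \<alpha> x = x \<bullet> (F *v x) + c \<bullet> x + \<alpha>"

definition sign_vectors :: "(real^'n) set" where
  "sign_vectors = {x. \<forall>i. x $ i \<in> {-1, 1}}"

definition Delta :: "real^'n^'m \<Rightarrow> real^'m \<Rightarrow> (real^'n) set" where
  "Delta A b = {x \<in> sign_vectors. A *v x = b}"

definition Delta_c :: "real^'n^'m \<Rightarrow> real^'m \<Rightarrow> (real^'n) set" where
  "Delta_c A b = {x \<in> sign_vectors. A *v x \<noteq> b}"

end

theory Submission
  imports Defs
begin

text \<open>For a sign vector \<open>x\<close> the pair \<open>(x x\<^sup>T, x)\<close> is feasible for the semidefinite programs with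
  objective value \<open>f x\<close>, and the feasible set is compact since a positive semidefinite matrix with
  unit diagonal has entries in \<open>[-1, 1]\<close>; hence the extrema are attained and
  \<open>\<bar>f x\<bar> \<le> \<rho>\<close>. Moreover \<open>A x - b = A_hat ((x + e) / 2) - b_hat\<close> is an integer vector because
  \<open>x + e\<close> has entries in \<open>{0, 2}\<close>, so on \<open>\<Delta>\<^sup>c\<close> the penalty is at least \<open>\<sigma> = 2 \<rho> + 1\<close>.\<close>

lemma sum_UNIV_option:
  fixes g :: "'n::finite option \<Rightarrow> 'b::comm_monoid_add"
  shows "(\<Sum>i\<in>UNIV. g i) = g None + (\<Sum>k\<in>UNIV. g (Some k))"
  by (simp add: UNIV_option_conv sum.reindex)

text \<open>Expanding the form serves two ends: for fixed \<open>v\<close> it is visibly continuous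
  in \<open>(X, x)\<close>, and for \<open>X = x x\<^sup>T\<close> it collapses to a perfect
  square.\<close>

lemma bordered_quadratic_form:
  "v \<bullet> (bordered x X *v v) =
     (v $ None)\<^sup>2 + 2 * v $ None * (\<Sum>k\<in>UNIV. x $ k * v $ Some k)
     + (\<Sum>k\<in>UNIV. v $ Some k * (\<Sum>l\<in>UNIV. X $ k $ l * v $ Some l))"
  by (simp add: inner_vec_def matrix_vector_mult_def bordered_def sum_UNIV_option
      algebra_simps power2_eq_square sum.distrib sum_distrib_left)

lemma symmetric_matrix_iff: "symmetric_matrix M \<longleftrightarrow> (\<forall>i j. M $ i $ j = M $ j $ i)"
  by (auto simp: symmetric_matrix_def transpose_def vec_eq_iff)

lemma symmetric_bordered: "symmetric_matrix X \<Longrightarrow> symmetric_matrix (bordered x X)"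
  unfolding symmetric_matrix_iff bordered_def by (simp split: option.split)

lemma sdp_feasible_iff:
  "(X, x) \<in> sdp_feasible \<longleftrightarrow>
     (\<forall>i j. X $ i $ j = X $ j $ i) \<and> (\<forall>v. 0 \<le> v \<bullet> (bordered x X *v v)) \<and> (\<forall>i. X $ i $ i = 1)"
proof -
  have "diag_vec X = 1 \<longleftrightarrow> (\<forall>i. X $ i $ i = 1)"
    by (simp add: diag_vec_def vec_eq_iff)
  then show ?thesis
    unfolding sdp_feasible_def pos_semidef_def symmetric_matrix_iff[symmetric]
    using symmetric_bordered[of X x] by blast
qed

text \<open>Passing to the library inner product makes the continuity of the objective
  automatic.\<close>

lemma frob_inner_eq_inner: "frob_inner M X = M \<bullet> X"
proof -
  have "frob_inner M X = (\<Sum>i\<in>UNIV. \<Sum>k\<in>UNIV. X $ k $ i * M $ k $ i)"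
    by (simp add: frob_inner_def trace_def matrix_matrix_mult_def transpose_def)
  also have "\<dots> = (\<Sum>k\<in>UNIV. \<Sum>i\<in>UNIV. M $ k $ i * X $ k $ i)"
    by (subst sum.swap) (simp add: mult.commute)
  finally show ?thesis by (simp add: inner_vec_def)
qed

text \<open>Off the diagonal, test the form on \<open>axis i 1 + t *\<^sub>R axis j 1\<close> with
  \<open>t = 1\<close> and \<open>t = -1\<close>: the diagonal contributes 2 and symmetry merges the
  cross terms, so \<open>0 \<le> 2 + 2 * t * M $ i $ j\<close> for both signs.\<close>

lemma symmetric_psd_entry_le_1:
  fixes M :: "real^'k^'k"
  assumes "pos_semidef M" "\<And>i. M $ i $ i = 1"
  shows "\<bar>M $ i $ j\<bar> \<le> 1"
proof (cases "i = j")
  case False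
  have form: "0 \<le> 2 + 2 * t * M $ i $ j" if "t\<^sup>2 = 1" for t
  proof -
    let ?v = "axis i 1 + t *\<^sub>R axis j 1 :: real^'k"
    have entry: "axis k 1 \<bullet> (M *v axis l 1) = M $ k $ l" for k l
      by (simp add: inner_axis' matrix_vector_mult_basis column_def)
    have "0 \<le> ?v \<bullet> (M *v ?v)"
      using assms(1) by (simp add: pos_semidef_def)
    also have "\<dots> = M $ i $ i + t * M $ i $ j + t * M $ j $ i + t\<^sup>2 * M $ j $ j"
      by (simp add: matrix_vector_right_distrib matrix_vector_mult_scaleR inner_add_left
          inner_add_right entry algebra_simps power2_eq_square)
    also have "M $ j $ i = M $ i $ j"
      using assms(1) by (simp add: pos_semidef_def symmetric_matrix_iff)
    finally show ?thesis using that by (simp add: assms(2))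
  qed
  from form[of 1] form[of "-1"] show ?thesis by simp
qed (simp add: assms(2))

text \<open>The corner 1 and the unit diagonal of \<open>X\<close> give the bordered matrix a unit
  diagonal; \<open>x\<close> is read off from its \<open>None\<close> row.\<close>

lemma sdp_feasible_entry_le_1:
  assumes "(X, x) \<in> sdp_feasible"
  shows "\<bar>X $ i $ j\<bar> \<le> 1" "\<bar>x $ i\<bar> \<le> 1"
proof -
  have "pos_semidef (bordered x X)"
    using assms by (simp add: sdp_feasible_def)
  moreover have "bordered x X $ k $ k = 1" for k
    using assms by (cases k) (simp_all add: bordered_def sdp_feasible_iff)
  ultimately have *: "\<bar>bordered x X $ k $ l\<bar> \<le> 1" for k l
    by (rule symmetric_psd_entry_le_1)
  show "\<bar>X $ i $ j\<bar> \<le> 1" using *[of "Some i" "Some j"] by (simp add: bordered_def)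
  show "\<bar>x $ i\<bar> \<le> 1" using *[of None "Some i"] by (simp add: bordered_def)
qed

text \<open>Crude l1 estimates suffice: a vector with entries in [-1, 1] has norm at most n, and a
  matrix has norm at most the sum of its n row norms.\<close>

lemma bounded_sdp_feasible: "bounded (sdp_feasible :: ((real^'n^'n) \<times> (real^'n)) set)"
proof (rule bounded_subset)
  let ?n = "real CARD('n)"
  have vec: "norm y \<le> ?n" if "\<And>i. \<bar>y $ i\<bar> \<le> 1" for y :: "real^'n"
    using norm_le_l1_cart[of y] sum_bounded_above[of UNIV "\<lambda>i. \<bar>y $ i\<bar>" 1] that by simp
  have mat: "norm X \<le> ?n * ?n" if "\<And>i j. \<bar>X $ i $ j\<bar> \<le> 1" for X :: "real^'n^'n"
  proof -
    have "norm X \<le> (\<Sum>i\<in>UNIV. norm (X $ i))"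
      unfolding norm_vec_def[of X] by (rule L2_set_le_sum) simp
    also have "\<dots> \<le> ?n * ?n"
      using sum_bounded_above[of UNIV "\<lambda>i. norm (X $ i)" ?n] that by (simp add: vec)
    finally show ?thesis .
  qed
  show "sdp_feasible \<subseteq> cball (0 :: real^'n^'n) (?n * ?n) \<times> cball (0 :: real^'n) ?n"
    by (auto intro!: vec mat intro: sdp_feasible_entry_le_1)
qed (intro bounded_Times bounded_cball)

lemma closed_sdp_feasible: "closed (sdp_feasible :: ((real^'n^'n) \<times> (real^'n)) set)"
proof -
  have "sdp_feasible = {p :: (real^'n^'n) \<times> (real^'n).
      (\<forall>i j. fst p $ i $ j = fst p $ j $ i) \<and>
      (\<forall>v. 0 \<le> v \<bullet> (bordered (snd p) (fst p) *v v)) \<and> (\<forall>i. fst p $ i $ i = 1)}"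
    by (auto simp: sdp_feasible_iff)
  \<comment> \<open>The set is an intersection, over all indices and all \<open>v\<close>, of
    equations and weak inequalities between continuous functions of the pair.\<close>
  also have "closed \<dots>"
    unfolding bordered_quadratic_form
    by (intro closed_Collect_conj closed_Collect_all closed_Collect_eq closed_Collect_le
        continuous_intros)
  finally show ?thesis .
qed

lemma sign_vector_sq: "x \<in> sign_vectors \<Longrightarrow> x $ i * x $ i = 1"
  by (auto simp: sign_vectors_def dest: spec[of _ i])

text \<open>The bordered matrix is here the rank-one matrix \<open>(1, x) (1, x)\<^sup>T\<close>, so
  its form at \<open>v\<close> is the square of the inner product of \<open>v\<close> with
  \<open>(1, x)\<close>.\<close>

lemma sign_vector_feasible:
  assumes "x \<in> sign_vectors"
  shows "((\<chi> i j. x $ i * x $ j), x) \<in> sdp_feasible"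
proof -
  have "v \<bullet> (bordered x (\<chi> i j. x $ i * x $ j) *v v) =
      (v $ None + (\<Sum>k\<in>UNIV. x $ k * v $ Some k))\<^sup>2" for v
  proof -
    have "(\<Sum>k\<in>UNIV. v $ Some k * (\<Sum>l\<in>UNIV. x $ k * x $ l * v $ Some l)) =
        (\<Sum>k\<in>UNIV. x $ k * v $ Some k)\<^sup>2"
      unfolding power2_eq_square sum_product by (simp add: sum_distrib_left mult.left_commute mult.assoc)
    then show ?thesis
      unfolding bordered_quadratic_form by (simp add: power2_sum)
  qed
  then show ?thesis
    by (simp add: sdp_feasible_iff sign_vector_sq[OF assms] mult.commute)
qed

lemma quad_fun_mem_sdp_values:
  assumes "x \<in> sign_vectors"
  shows "quad_fun F c \<alpha> x \<in> sdp_values F c \<alpha>"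
proof -
  have "x \<bullet> (F *v x) = frob_inner F (\<chi> i j. x $ i * x $ j)"
    by (simp add: frob_inner_eq_inner inner_vec_def matrix_vector_mult_def sum_distrib_left ac_simps)
  then show ?thesis
    using sign_vector_feasible[OF assms] by (auto simp: sdp_values_def quad_fun_def)
qed

lemma compact_sdp_values: "compact (sdp_values F c \<alpha>)"
proof -
  have "sdp_values F c \<alpha> = (\<lambda>p. F \<bullet> fst p + c \<bullet> snd p + \<alpha>) ` sdp_feasible"
    by (force simp: sdp_values_def frob_inner_eq_inner)
  also have "compact \<dots>"
    by (intro compact_continuous_image continuous_intros)
       (simp add: compact_eq_bounded_closed bounded_sdp_feasible closed_sdp_feasible)
  finally show ?thesis .
qed

text \<open>Compactness, with \<open>v\<close> itself as witness of nonemptiness, yields attained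
  extrema; only then are \<open>l_hat\<close> and \<open>u_hat\<close> identified with them, and
  \<open>v\<close> lies between the two.\<close>

lemma abs_le_rho_Las:
  assumes "v \<in> sdp_values F c \<alpha>"
  shows "\<bar>v\<bar> \<le> rho_Las F c \<alpha>"
proof -
  let ?S = "sdp_values F c \<alpha>"
  obtain l where l: "l \<in> ?S" "\<And>w. w \<in> ?S \<Longrightarrow> l \<le> w"
    using compact_attains_inf[OF compact_sdp_values] assms by blast
  obtain u where u: "u \<in> ?S" "\<And>w. w \<in> ?S \<Longrightarrow> w \<le> u"
    using compact_attains_sup[OF compact_sdp_values] assms by blast
  have "l_hat F c \<alpha> = l" "u_hat F c \<alpha> = u"
    unfolding l_hat_def u_hat_def using l u by (auto intro: Least_equality Greatest_equality)
  then show ?thesis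
    using l(2)[OF assms] u(2)[OF assms] by (auto simp: rho_Las_def)
qed

lemma norm_ge_1_of_Ints:
  fixes y :: "real^'m"
  assumes "\<And>i. y $ i \<in> \<int>" "y \<noteq> 0"
  shows "1 \<le> norm y"
proof -
  obtain i where "y $ i \<noteq> 0" using assms(2) by (auto simp: vec_eq_iff)
  then have "1 \<le> \<bar>y $ i\<bar>" using assms(1) by (rule Ints_nonzero_abs_ge1[rotated])
  also have "\<dots> \<le> norm y" by (rule component_le_norm_cart)
  finally show ?thesis .
qed

lemma residual_in_Ints:
  fixes A_hat :: "int^'n^'m" and b_hat :: "int^'m" and x :: "real^'n"
  assumes "x \<in> sign_vectors"
  shows "(((1/2) *\<^sub>R map_matrix real_of_int A_hat) *v x
    - ((\<chi> i. real_of_int (b_hat $ i)) - (1/2) *\<^sub>R (map_matrix real_of_int A_hat *v 1))) $ i \<in> \<int>"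
    (is "?r $ i \<in> \<int>")
proof -
  \<comment> \<open>The substitution \<open>y = (x + e) / 2\<close> returns to 0/1 variables, in
    which the constraint has integer data.\<close>
  have "?r $ i = (\<Sum>j\<in>UNIV. real_of_int (A_hat $ i $ j) * ((x $ j + 1) / 2)) - real_of_int (b_hat $ i)"
    by (simp add: matrix_vector_mult_def map_matrix_def sum_divide_distrib distrib_left
        add_divide_distrib sum.distrib sum_distrib_left)
  moreover have "(x $ j + 1) / 2 \<in> \<int>" for j
    using assms by (auto simp: sign_vectors_def dest!: spec[of _ j])
  ultimately show ?thesis by (simp only:) (intro Ints_diff Ints_sum Ints_mult Ints_of_int)
qed

theorem lemma3:
  fixes F_hat F :: "real^'n^'n" and c_hat c e :: "real^'n"
    and A_hat :: "int^'n^'m" and b_hat :: "int^'m"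
    and A :: "real^'n^'m" and b :: "real^'m"
    and \<alpha> :: real and f :: "real^'n \<Rightarrow> real"
  assumes "symmetric_matrix F_hat"
  defines "e \<equiv> 1"
  defines "F \<equiv> (1/4) *\<^sub>R F_hat"
    and "c \<equiv> (1/2) *\<^sub>R (c_hat + F_hat *v e)"
    and "\<alpha> \<equiv> (1/2) * (c_hat \<bullet> e) + (1/4) * (e \<bullet> (F_hat *v e))"
    and "A \<equiv> (1/2) *\<^sub>R map_matrix real_of_int A_hat"
    and "b \<equiv> (\<chi> i. real_of_int (b_hat $ i)) - (1/2) *\<^sub>R (map_matrix real_of_int A_hat *v e)"
    and "f \<equiv> quad_fun F c \<alpha>"
  shows "(\<not> (\<exists>x \<in> Delta A b. f x > rho_Las F c \<alpha>)) \<and>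
         (\<forall>x \<in> Delta_c A b. f x + sigma_Las F c \<alpha> * (norm (A *v x - b))\<^sup>2 > rho_Las F c \<alpha>)"
proof (intro conjI ballI)
  have bound: "\<bar>f x\<bar> \<le> rho_Las F c \<alpha>" if "x \<in> sign_vectors" for x
    unfolding f_def by (intro abs_le_rho_Las quad_fun_mem_sdp_values that)
  then show "\<not> (\<exists>x \<in> Delta A b. f x > rho_Las F c \<alpha>)"
    by (fastforce simp: Delta_def)
  fix x assume "x \<in> Delta_c A b"
  then have x: "x \<in> sign_vectors" "A *v x - b \<noteq> 0" by (auto simp: Delta_c_def)
  have "1 \<le> norm (A *v x - b)"
    using residual_in_Ints[OF x(1)] x(2) unfolding A_def b_def e_def by (rule norm_ge_1_of_Ints)
  then have "1 \<le> (norm (A *v x - b))\<^sup>2" by simp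
  moreover have sigma: "sigma_Las F c \<alpha> = 2 * rho_Las F c \<alpha> + 1"
    by (simp add: sigma_Las_def rho_Las_def)
  moreover have "0 \<le> rho_Las F c \<alpha>" by (simp add: rho_Las_def)
  \<comment> \<open>With \<rho> and \<sigma> for \<open>rho_Las\<close> and
    \<open>sigma_Las\<close>: monotonicity uses \<sigma> \<ge> 0. Since f x \<ge> -\<rho>, the
    penalized value is at least -\<rho> + \<sigma> = \<rho> + 1; the summand 1 in \<sigma> makes the
    inequality strict.\<close>
  ultimately have "sigma_Las F c \<alpha> * 1 \<le> sigma_Las F c \<alpha> * (norm (A *v x - b))\<^sup>2"
    by (intro mult_left_mono) auto
  then show "f x + sigma_Las F c \<alpha> * (norm (A *v x - b))\<^sup>2 > rho_Las F c \<alpha>"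
    using bound[OF x(1)] sigma by linarith
qed

end
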